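(* Let $a\geq 0$ be a real number and define $$f(z)=\frac{\Gamma(z+a)\,\Gamma(z-a)}{\Gamma(z)^2},\qquad z>a.$$ Then $f$ is a completely monotonic function on the interval $(a,\infty)$.
   Context: $\Gamma(x)=\int_0^\infty e^{-t}t^{x-1}\,dt$ for $x>0$ is the gamma function. A real function $f$ is called completely monotonic on an interval $I\subset\mathbb{R}$ if it has derivatives $f^{(n)}$ of every order $n=0,1,2,\dots$ on $I$ and $(-1)^n f^{(n)}(z)\geq 0$ for all $z\in I$ and all $n\geq 0$. *)

theory Defs
  imports "HOL-Analysis.Analysis"
begin

(* D n is the n-th derivative of f on I; it is unique when I is an interval with more than
   one point.  Derivatives are taken within I, so they are one-sided at an end point of I
   that belongs to I, and two-sided if I is open. *)
definition completely_monotonic_on :: "(real \<Rightarrow> real) \<Rightarrow> real set \<Rightarrow> bool" where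
  "completely_monotonic_on f I \<longleftrightarrow>
     (\<exists>D :: nat \<Rightarrow> real \<Rightarrow> real.
        (\<forall>z\<in>I. D 0 z = f z) \<and>
        (\<forall>n. \<forall>z\<in>I. (D n has_real_derivative D (Suc n) z) (at z within I)) \<and>
        (\<forall>n. \<forall>z\<in>I. (-1) ^ n * D n z \<ge> 0))"

end

theory Submission
  imports Defs
begin

text \<open>
  Put \<open>h z = ln \<Gamma>(z + a) + ln \<Gamma>(z - a) - 2 ln \<Gamma>(z)\<close>. The \<open>n\<close>-th derivative of \<open>h\<close> is a second
  difference with step \<open>a\<close> of the \<open>n\<close>-th derivative of \<open>ln \<Gamma>\<close>. Since \<open>(-1)^n\<close> times the \<open>(n+2)\<close>-nd
  derivative of \<open>ln \<Gamma>\<close> is positive on the positive axis, the \<open>n\<close>-th one is convex up to the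
  sign \<open>(-1)^n\<close>, so \<open>h\<close> is completely monotonic. Its exponential then is as well, because
  \<open>f' = h' f\<close> and the Leibniz rule give the signs of the derivatives recursively.
\<close>

text \<open>One differentiation of a Leibniz sum, by Pascal's rule. The premises stop at order
  \<open>n\<close>, so a strong induction can use this while the later derivatives of
  \<open>B\<close> are still unproved.\<close>

lemma DERIV_Leibniz_sum:
  fixes A B :: "nat \<Rightarrow> 'a::real_normed_field \<Rightarrow> 'a"
  assumes A: "\<And>k. k \<le> n \<Longrightarrow> (A k has_field_derivative A (Suc k) z) (at z within S)"
    and B: "\<And>k. k \<le> n \<Longrightarrow> (B k has_field_derivative B (Suc k) z) (at z within S)"
  shows "((\<lambda>z. \<Sum>k\<le>n. of_nat (n choose k) * A k z * B (n - k) z) has_field_derivative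
           (\<Sum>k\<le>Suc n. of_nat (Suc n choose k) * A k z * B (Suc n - k) z)) (at z within S)"
proof -
  let ?F = "\<lambda>n k. of_nat (n choose k) * A (Suc k) z * B (n - k) z"
  let ?G = "\<lambda>k. of_nat (n choose k) * A k z * B (Suc n - k) z"
  have "((\<lambda>z. of_nat (n choose k) * A k z * B (n - k) z) has_field_derivative ?F n k + ?G k)
          (at z within S)" if "k \<le> n" for k
    using DERIV_mult[OF DERIV_cmult[OF A[OF that]] B[OF diff_le_self],
        of "of_nat (n choose k)" k] that
    by (simp add: Suc_diff_le algebra_simps)
  then have "((\<lambda>z. \<Sum>k\<le>n. of_nat (n choose k) * A k z * B (n - k) z) has_field_derivative
               (\<Sum>k\<le>n. ?F n k + ?G k)) (at z within S)"
    by (intro DERIV_sum) simp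
  moreover have "(\<Sum>k\<le>Suc n. of_nat (Suc n choose k) * A k z * B (Suc n - k) z)
                   = (\<Sum>k\<le>n. ?F n k + ?G k)"
  proof -
    have "(\<Sum>k\<le>Suc n. of_nat (Suc n choose k) * A k z * B (Suc n - k) z)
            = ?G 0 + (\<Sum>k\<le>n. ?F n k + ?G (Suc k))"
      by (simp add: sum.atMost_Suc_shift algebra_simps del: sum.atMost_Suc)
    also have "\<dots> = (\<Sum>k\<le>n. ?F n k) + (\<Sum>k\<le>Suc n. ?G k)"
      by (simp add: sum.atMost_Suc_shift sum.distrib del: sum.atMost_Suc)
    \<comment> \<open>The top term \<open>?G (Suc n)\<close> vanishes, as its binomial coefficient
      is zero.\<close>
    also have "\<dots> = (\<Sum>k\<le>n. ?F n k + ?G k)"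
      by (simp add: sum.distrib binomial_eq_0)
    finally show ?thesis .
  qed
  ultimately show ?thesis by simp
qed

text \<open>If \<open>H k\<close> is the \<open>k\<close>-th derivative of \<open>h\<close>, this is
  the \<open>n\<close>-th derivative of \<open>exp h\<close>: the Leibniz rule for the product of
  \<open>h'\<close> and \<open>exp h\<close>.\<close>

fun exp_deriv :: "(nat \<Rightarrow> real \<Rightarrow> real) \<Rightarrow> nat \<Rightarrow> real \<Rightarrow> real" where
  "exp_deriv H 0 z = exp (H 0 z)"
| "exp_deriv H (Suc n) z =
     (\<Sum>k\<le>n. of_nat (n choose k) * H (Suc k) z * exp_deriv H (n - k) z)"

lemma DERIV_exp_deriv:
  assumes H: "\<And>k. (H k has_real_derivative H (Suc k) z) (at z within S)"
  shows "(exp_deriv H n has_real_derivative exp_deriv H (Suc n) z) (at z within S)"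
proof (induction n rule: less_induct)
  case (less n)
  show ?case
  proof (cases n)
    case 0
    have "((\<lambda>z. exp (H 0 z)) has_real_derivative exp (H 0 z) * H 1 z) (at z within S)"
      using DERIV_chain2[OF DERIV_exp H[of 0]] by simp
    then show ?thesis using 0 by (simp add: mult.commute)
  next
    case (Suc m)
    have "((\<lambda>z. \<Sum>k\<le>m. of_nat (m choose k) * H (Suc k) z * exp_deriv H (m - k) z)
            has_real_derivative
            (\<Sum>k\<le>Suc m. of_nat (Suc m choose k) * H (Suc k) z * exp_deriv H (Suc m - k) z))
            (at z within S)"
      \<comment> \<open>The index of \<open>A\<close> is shifted by one because the first factor is
        \<open>h'\<close>; the induction hypothesis covers the orders up to \<open>m\<close> of the
        second factor.\<close>
      by (rule DERIV_Leibniz_sum[where A = "\<lambda>k. H (Suc k)"]) (use H less Suc in auto)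
    then show ?thesis
      unfolding Suc exp_deriv.simps(2)[abs_def] .
  qed
qed

text \<open>Since \<open>Suc m = Suc k + (m - k)\<close>, the sign splits over the two factors of
  each summand, leaving a sum of nonnegative products. The base case is positivity of
  \<open>exp\<close>.\<close>

lemma exp_deriv_sign:
  assumes H: "\<And>k. (-1) ^ Suc k * H (Suc k) z \<ge> 0"
  shows "(-1) ^ n * exp_deriv H n z \<ge> 0"
proof (induction n rule: less_induct)
  case (less n)
  show ?case
  proof (cases n)
    case (Suc m)
    have "(-1) ^ Suc m * exp_deriv H (Suc m) z =
            (\<Sum>k\<le>m. of_nat (m choose k) * ((-1) ^ Suc k * H (Suc k) z)
               * ((-1) ^ (m - k) * exp_deriv H (m - k) z))"
      unfolding exp_deriv.simps sum_distrib_left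
    proof (rule sum.cong)
      fix k assume "k \<in> {..m}"
      then have "(-1 :: real) ^ Suc m = (-1) ^ Suc k * (-1) ^ (m - k)"
        by (simp flip: power_add)
      then show "(-1) ^ Suc m * (of_nat (m choose k) * H (Suc k) z * exp_deriv H (m - k) z) =
          of_nat (m choose k) * ((-1) ^ Suc k * H (Suc k) z)
            * ((-1) ^ (m - k) * exp_deriv H (m - k) z)"
        by (simp only: mult_ac)
    qed simp
    also have "\<dots> \<ge> 0"
      by (intro sum_nonneg mult_nonneg_nonneg H less) (use Suc in auto)
    finally show ?thesis using Suc by simp
  qed simp
qed

lemma completely_monotonic_on_exp:
  assumes "completely_monotonic_on h S"
  shows "completely_monotonic_on (\<lambda>z. exp (h z)) S"
proof -
  obtain H where H: "\<And>z. z \<in> S \<Longrightarrow> H 0 z = h z"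
    "\<And>n z. z \<in> S \<Longrightarrow> (H n has_real_derivative H (Suc n) z) (at z within S)"
    "\<And>n z. z \<in> S \<Longrightarrow> (-1) ^ n * H n z \<ge> 0"
    using assms unfolding completely_monotonic_on_def by blast
  show ?thesis
    unfolding completely_monotonic_on_def
    by (intro exI[of _ "exp_deriv H"] conjI ballI allI DERIV_exp_deriv exp_deriv_sign H)
      (simp_all add: H)
qed

lemma completely_monotonic_on_cong:
  assumes "completely_monotonic_on f S" "\<And>z. z \<in> S \<Longrightarrow> f z = g z"
  shows "completely_monotonic_on g S"
  using assms unfolding completely_monotonic_on_def by simp

text \<open>\<open>Polygamma m\<close> is the derivative of order \<open>m + 1\<close> of
  \<open>ln_Gamma\<close>; the case split makes the index equal to the order.\<close>

definition ln_Gamma_deriv :: "nat \<Rightarrow> real \<Rightarrow> real" where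
  "ln_Gamma_deriv n = (case n of 0 \<Rightarrow> ln_Gamma | Suc m \<Rightarrow> Polygamma m)"

lemma DERIV_ln_Gamma_deriv:
  assumes "x > 0"
  shows "(ln_Gamma_deriv n has_real_derivative ln_Gamma_deriv (Suc n) x) (at x within S)"
  using assms
  by (cases n) (auto simp: ln_Gamma_deriv_def nonpos_Ints_def
      intro!: has_field_derivative_Polygamma
        has_field_derivative_at_within[OF has_field_derivative_ln_Gamma_real])

lemma convex_ln_Gamma_deriv: "convex_on {0<..} (\<lambda>x. (-1) ^ n * ln_Gamma_deriv n x)"
proof (rule f''_ge0_imp_convex)
  fix x :: real assume "x \<in> {0<..}"
  then have x: "x > 0" by simp
  show "((\<lambda>x. (-1) ^ n * ln_Gamma_deriv n x) has_real_derivative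
          (-1) ^ n * ln_Gamma_deriv (Suc n) x) (at x)"
    by (intro DERIV_cmult DERIV_ln_Gamma_deriv x)
  show "((\<lambda>x. (-1) ^ n * ln_Gamma_deriv (Suc n) x) has_real_derivative
          (-1) ^ n * ln_Gamma_deriv (Suc (Suc n)) x) (at x)"
    by (intro DERIV_cmult DERIV_ln_Gamma_deriv x)
  \<comment> \<open>The function here is \<open>Polygamma (Suc n)\<close>: positive for even
    \<open>n\<close>, negative for odd \<open>n\<close>.\<close>
  show "0 \<le> (-1) ^ n * ln_Gamma_deriv (Suc (Suc n)) x"
    using Polygamma_real_odd_pos[of x "Suc n"] Polygamma_real_even_neg[of x "Suc n"] x
    by (cases "even n") (auto simp: ln_Gamma_deriv_def nonpos_Ints_def less_imp_le)
qed simp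

text \<open>Convexity at the midpoint \<open>x\<close> of \<open>x - a\<close> and
  \<open>x + a\<close>.\<close>

lemma convex_on_second_difference_nonneg:
  fixes f :: "real \<Rightarrow> real"
  assumes "convex_on S f" "x - a \<in> S" "x + a \<in> S"
  shows "f (x + a) + f (x - a) - 2 * f x \<ge> 0"
  using convex_onD[OF assms(1), of "1/2" "x - a" "x + a"] assms(2,3) by (simp add: field_simps)

lemma completely_monotonic_on_ln_Gamma_second_difference:
  assumes "a \<ge> 0"
  shows "completely_monotonic_on (\<lambda>z. ln_Gamma (z + a) + ln_Gamma (z - a) - 2 * ln_Gamma z) {a<..}"
proof -
  define H where "H n z = ln_Gamma_deriv n (z + a) + ln_Gamma_deriv n (z - a)
    - 2 * ln_Gamma_deriv n z" for n z
  have shift: "((\<lambda>z. ln_Gamma_deriv n (z + c)) has_real_derivative ln_Gamma_deriv (Suc n) (z + c))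
      (at z within S)" if "z + c > 0" for n z c S
    \<comment> \<open>\<open>DERIV_shift\<close> concerns two-sided derivatives, so the restriction
      to \<open>S\<close> comes after the translation.\<close>
    using DERIV_ln_Gamma_deriv[OF that, of n UNIV]
    by (simp add: DERIV_shift has_field_derivative_at_within)
  have "(H n has_real_derivative H (Suc n) z) (at z within {a<..})" if "z > a" for n z
    using DERIV_diff[OF DERIV_add[OF shift[of z a] shift[of z "-a"]] DERIV_cmult[OF shift[of z 0]]]
      that assms by (simp add: H_def[abs_def])
  moreover have "(-1) ^ n * H n z \<ge> 0" if "z > a" for n z
    using convex_on_second_difference_nonneg[OF convex_ln_Gamma_deriv[of n], of z a] that assms
    by (simp add: H_def algebra_simps)
  moreover have "H 0 z = ln_Gamma (z + a) + ln_Gamma (z - a) - 2 * ln_Gamma z" for z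
    by (simp add: H_def ln_Gamma_deriv_def)
  ultimately show ?thesis
    unfolding completely_monotonic_on_def by (intro exI[of _ H]) auto
qed

theorem theorem2p5:
  fixes a :: real
  assumes "a \<ge> 0"
  shows "completely_monotonic_on (\<lambda>z. Gamma (z + a) * Gamma (z - a) / (Gamma z)\<^sup>2) {a<..}"
proof (rule completely_monotonic_on_cong[OF completely_monotonic_on_exp[OF
        completely_monotonic_on_ln_Gamma_second_difference[OF assms]]])
  fix z assume "z \<in> {a<..}"
  then show "exp (ln_Gamma (z + a) + ln_Gamma (z - a) - 2 * ln_Gamma z)
      = Gamma (z + a) * Gamma (z - a) / (Gamma z)\<^sup>2"
    \<comment> \<open>From \<open>z > a\<close> and \<open>a >= 0\<close>, all three arguments are
      positive, so \<open>Gamma\<close> is \<open>exp\<close> of \<open>ln_Gamma\<close> at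
      each.\<close>
    using assms by (simp add: Gamma_real_pos_exp exp_add exp_diff exp_double)
qed

end
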